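(* Let $\beta\in(0,1)$ and let $E_t=\inf\{u>0:D_u>t\}$ be the inverse of a subordinator $(D_t)_{t\ge0}$ whose Laplace exponent $\phi$ is regularly varying at $\infty$ with index $\beta$. Then for any fixed $p>0$ and $\delta>0$, $$\mathbb{E}[E_t^p]\sim\mathbb{E}[E_t^p\,\mathbf{1}_{\{E_t\le\delta\}}]\sim\frac{\Gamma(p+1)}{\Gamma(p\beta+1)}[\phi(t^{-1})]^{-p}\quad\text{as }t\downarrow0.$$ In particular, for all $\delta_1,\delta_2>0$, $$\lim_{t\downarrow0}\frac{\mathbb{E}[\sqrt{E_t}\,\mathbf{1}_{\{E_t\le\delta_1\}}]}{\mathbb{E}[\sqrt{E_t}\,\mathbf{1}_{\{E_t\le\delta_2\}}]}=1.$$
   Context: Subordinator: a subordinator $(D_t)$ with Laplace exponent $\phi$ is a strictly increasing one-dimensional Lévy process with càdlàg paths, $D_0=0$, killing rate $0$, drift $0$, and infinite Lévy measure $\nu$ ($\nu((0,\infty))=\infty$, $\int_0^\infty(y\wedge1)\,\nu(dy)<\infty$), with $\mathbb{E}[e^{-sD_t}]=e^{-t\phi(s)}$, $\phi(s)=\int_0^\infty(1-e^{-sy})\,\nu(dy)$. A function $f:(0,\infty)\to(0,\infty)$ is regularly varying at $\infty$ with index $\rho$ if $f(cs)/f(s)\to c^\rho$ as $s\to\infty$ for each $c>0$. $f\sim g$ means $f/g\to1$. *)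

theory Defs
  imports "HOL-Probability.Probability"
begin

definition cadlag_on_nonneg :: "(real \<Rightarrow> real) \<Rightarrow> bool" where
  "cadlag_on_nonneg x \<longleftrightarrow>
     (\<forall>t\<ge>0. (x \<longlongrightarrow> x t) (at_right t)) \<and>
     (\<forall>t>0. \<exists>l. (x \<longlongrightarrow> l) (at_left t))"

(* Only the times t >= 0 matter; D t is unconstrained for t < 0.  Stochastic continuity is
   not listed, since it follows from right-continuous paths and stationary increments. *)
locale cadlag_levy_process = prob_space M for M :: "'a measure" +
  fixes D :: "real \<Rightarrow> 'a \<Rightarrow> real"
  assumes random_variable_D: "\<And>t. 0 \<le> t \<Longrightarrow> random_variable borel (D t)"
    and D_zero: "AE \<omega> in M. D 0 \<omega> = 0"
    and indep_increments:
      "\<And>(\<tau> :: nat \<Rightarrow> real) n. 0 \<le> \<tau> 0 \<Longrightarrow> mono_on {..n} \<tau> \<Longrightarrow>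
         indep_vars (\<lambda>_. borel) (\<lambda>i \<omega>. D (\<tau> (Suc i)) \<omega> - D (\<tau> i) \<omega>) {..<n}"
    and stationary_increments:
      "\<And>s t. 0 \<le> s \<Longrightarrow> s \<le> t \<Longrightarrow>
         distr M borel (\<lambda>\<omega>. D t \<omega> - D s \<omega>) = distr M borel (D (t - s))"
    and cadlag_paths: "AE \<omega> in M. cadlag_on_nonneg (\<lambda>t. D t \<omega>)"

definition laplace_exponent :: "real measure \<Rightarrow> real \<Rightarrow> real" where
  "laplace_exponent \<nu> s = (LINT y:{0<..}|\<nu>. 1 - exp (- s * y))"

(* Killing rate 0 and drift 0 are encoded by the shape of the Laplace exponent, which has
   neither a constant nor a linear term, and by D being real-valued. *)
locale subordinator = cadlag_levy_process M D for M :: "'a measure" and D +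
  fixes \<nu> :: "real measure"
  assumes strictly_increasing_paths: "AE \<omega> in M. strict_mono_on {0..} (\<lambda>t. D t \<omega>)"
    and sets_levy_measure: "sets \<nu> = sets borel"
    and levy_measure_support: "emeasure \<nu> {..0} = 0"
    and levy_measure_infinite: "emeasure \<nu> {0<..} = \<infinity>"
    and levy_measure_integrable: "(\<integral>\<^sup>+y\<in>{0<..}. ennreal (min y 1) \<partial>\<nu>) < \<infinity>"
    and laplace_transform:
      "\<And>s t. 0 < s \<Longrightarrow> 0 \<le> t \<Longrightarrow>
         expectation (\<lambda>\<omega>. exp (- s * D t \<omega>)) = exp (- t * laplace_exponent \<nu> s)"

(* Extended-valued, so that the infimum of the empty set is \<infinity>. *)
definition inverse_process :: "(real \<Rightarrow> 'a \<Rightarrow> real) \<Rightarrow> real \<Rightarrow> 'a \<Rightarrow> ennreal" where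
  "inverse_process D t \<omega> = (INF u\<in>{u. 0 < u \<and> t < D u \<omega>}. ennreal u)"

(* Meant for exponents p > 0. *)
definition ennreal_powr :: "ennreal \<Rightarrow> real \<Rightarrow> ennreal" where
  "ennreal_powr x p = (if x = \<infinity> then \<infinity> else ennreal (enn2real x powr p))"

definition ennreal_sqrt :: "ennreal \<Rightarrow> ennreal" where
  "ennreal_sqrt x = (if x = \<infinity> then \<infinity> else ennreal (sqrt (enn2real x)))"

definition regularly_varying_at_top :: "(real \<Rightarrow> real) \<Rightarrow> real \<Rightarrow> bool" where
  "regularly_varying_at_top f \<rho> \<longleftrightarrow>
     (\<forall>s>0. 0 < f s) \<and>
     (\<forall>c>0. ((\<lambda>s. f (c * s) / f s) \<longlongrightarrow> c powr \<rho>) at_top)"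

(* f / g tends to 1, the quotient being taken in [0,\<infinity>]; a limit of 1 forces f and g to be
   finite and nonzero eventually (the library asymp_equiv needs a normed field). *)
definition ennreal_asymp_equiv ::
    "('b \<Rightarrow> ennreal) \<Rightarrow> 'b filter \<Rightarrow> ('b \<Rightarrow> ennreal) \<Rightarrow> bool" where
  "ennreal_asymp_equiv f F g \<longleftrightarrow> ((\<lambda>x. f x / g x) \<longlongrightarrow> 1) F"

end

theory Submission
  imports Defs
begin

text \<open>
  Write \<open>\<phi>\<close> for the Laplace exponent and \<open>F\<^sub>p(t) = E[E\<^sub>t\<^sup>p]\<close>. Almost surely \<open>E\<^sub>t > u\<close> holds exactly when
  \<open>D\<^sub>u < t\<close> (\<open>less_inverse_process_iff\<close>). Expressing \<open>E\<^sub>t\<^sup>p\<close> by the layer-cake formula and exchanging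
  integrals therefore computes the Laplace transform of \<open>F\<^sub>p\<close> in \<open>t\<close> exactly: at \<open>s\<close> it equals
  \<open>\<Gamma>(p+1) / (s \<phi>(s)\<^sup>p)\<close> (\<open>laplace_inverse_moment\<close>).

  Since \<open>F\<^sub>p\<close> is increasing, a Tauberian argument of Karamata type recovers its behaviour at \<open>0\<close>. The
  rescaled functions \<open>x \<mapsto> F\<^sub>p(t x) \<phi>(1/t)\<^sup>p\<close> are increasing, and regular variation of \<open>\<phi>\<close> makes their
  Laplace transforms converge, as \<open>t\<close> decreases to \<open>0\<close>, to that of
  \<open>(\<Gamma>(p+1) / \<Gamma>(p\<beta>+1)) * (x powr (p\<beta>))\<close>. For monotone functions this forces convergence at every
  continuity point of the limit (\<open>tendsto_of_tendsto_laplace\<close>), and the point \<open>x = 1\<close> gives the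
  asymptotics of \<open>F\<^sub>p\<close> (\<open>real_inverse_moment_asymp\<close>).

  Truncating at \<open>\<delta>\<close> changes \<open>F\<^sub>p\<close> by at most \<open>F\<^sub>p\<^sub>+\<^sub>1 / \<delta>\<close>. The same asymptotics with \<open>p + 1\<close> in place of
  \<open>p\<close> show that this is smaller than \<open>F\<^sub>p\<close> by a factor of order \<open>1 / \<phi>(1/t)\<close>, which tends to \<open>0\<close>
  (\<open>real_truncated_moment_asymp\<close>). The statement about square roots is the case \<open>p = 1/2\<close> for two
  truncation levels.
\<close>

section \<open>Convergence of monotone functions from convergence of Laplace transforms\<close>

text \<open>
  Extending functions on the half-line by zero allows all integrals to run over the whole line.
  For the moments \<open>E[E\<^sub>t\<^sup>p]\<close> this extension is automatic, since almost surely
  \<open>E\<^sub>t = 0\<close> for \<open>t \<le> 0\<close>.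
\<close>

definition one_sided_laplace :: "(real \<Rightarrow> real) \<Rightarrow> bool" where
  "one_sided_laplace f \<longleftrightarrow>
     f \<in> borel_measurable borel \<and> (\<forall>x. 0 \<le> f x) \<and> (\<forall>x\<le>0. f x = 0) \<and>
     (\<forall>l>0. integrable lborel (\<lambda>x. exp (- l * x) * f x))"

lemma one_sided_laplaceD:
  assumes "one_sided_laplace f"
  shows "f \<in> borel_measurable borel" "0 \<le> f x" "x \<le> 0 \<Longrightarrow> f x = 0"
    "0 < l \<Longrightarrow> integrable lborel (\<lambda>x. exp (- l * x) * f x)"
  using assms by (auto simp: one_sided_laplace_def)

text \<open>
  On the support of \<open>f\<close> the argument \<open>exp (- x)\<close> lies in \<open>[0, 1]\<close>, where \<open>q\<close> is bounded; hence the
  Laplace integral of \<open>f\<close> at \<open>1\<close> dominates.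
\<close>

lemma integrable_exp_weight:
  fixes q :: "real \<Rightarrow> real"
  assumes f: "one_sided_laplace f" and q: "continuous_on UNIV q"
  shows "integrable lborel (\<lambda>x. exp (- x) * q (exp (- x)) * f x)"
proof -
  note [measurable] = one_sided_laplaceD(1)[OF f]
  have [measurable]: "q \<in> borel_measurable borel"
    using q by (rule borel_measurable_continuous_onI)
  have "compact (q ` {0..1})"
    by (rule compact_continuous_image[OF continuous_on_subset[OF q]]) auto
  then obtain B where B: "\<And>y. y \<in> {0..1} \<Longrightarrow> \<bar>q y\<bar> \<le> B"
    by (meson compact_imp_bounded bounded_real imageI)
  have *: "norm (exp (- x) * q (exp (- x)) * f x) \<le> norm (B * (exp (- 1 * x) * f x))" for x
  proof (cases "x \<le> 0")
    case True
    then show ?thesis using one_sided_laplaceD(3)[OF f] by simp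
  next
    case False
    then have b: "\<bar>q (exp (- x))\<bar> \<le> B" by (intro B) auto
    have "norm (exp (- x) * q (exp (- x)) * f x) = \<bar>q (exp (- x))\<bar> * (exp (- x) * f x)"
      using one_sided_laplaceD(2)[OF f, of x] by (simp add: abs_mult)
    also have "\<dots> \<le> B * (exp (- x) * f x)"
      using b one_sided_laplaceD(2)[OF f, of x] by (intro mult_right_mono) auto
    finally show ?thesis by simp
  qed
  show ?thesis
  proof (rule Bochner_Integration.integrable_bound)
    show "integrable lborel (\<lambda>x. B * (exp (- 1 * x) * f x))"
      using one_sided_laplaceD(4)[OF f, of 1] by simp
    show "AE x in lborel. norm (exp (- x) * q (exp (- x)) * f x) \<le> norm (B * (exp (- 1 * x) * f x))"
      using * by simp
  qed measurable
qed

lemma exp_weight_integral_diff_le: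
  fixes p q :: "real \<Rightarrow> real"
  assumes f: "one_sided_laplace f" and p: "continuous_on UNIV p" and q: "continuous_on UNIV q"
    and e: "\<And>y. y \<in> {0..1} \<Longrightarrow> \<bar>q y - p y\<bar> \<le> e"
  shows "\<bar>(\<integral>x. exp (- x) * q (exp (- x)) * f x \<partial>lborel) - (\<integral>x. exp (- x) * p (exp (- x)) * f x \<partial>lborel)\<bar>
    \<le> e * (\<integral>x. exp (- 1 * x) * f x \<partial>lborel)"
proof -
  have "\<bar>(\<integral>x. exp (- x) * q (exp (- x)) * f x \<partial>lborel) - (\<integral>x. exp (- x) * p (exp (- x)) * f x \<partial>lborel)\<bar>
     = norm (\<integral>x. exp (- x) * q (exp (- x)) * f x - exp (- x) * p (exp (- x)) * f x \<partial>lborel)"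
    by (simp add: Bochner_Integration.integral_diff integrable_exp_weight[OF f] p q)
  also have "\<dots> \<le> (\<integral>x. e * (exp (- 1 * x) * f x) \<partial>lborel)"
  proof (rule Bochner_Integration.integral_norm_bound_integral)
    show "integrable lborel (\<lambda>x. exp (- x) * q (exp (- x)) * f x - exp (- x) * p (exp (- x)) * f x)"
      by (intro Bochner_Integration.integrable_diff integrable_exp_weight[OF f] p q)
    show "integrable lborel (\<lambda>x. e * (exp (- 1 * x) * f x))"
      using one_sided_laplaceD(4)[OF f, of 1] by simp
    fix x
    show "norm (exp (- x) * q (exp (- x)) * f x - exp (- x) * p (exp (- x)) * f x) \<le> e * (exp (- 1 * x) * f x)"
    proof (cases "x \<le> 0")
      case True
      then show ?thesis using one_sided_laplaceD(3)[OF f] by simp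
    next
      case False
      have "norm (exp (- x) * q (exp (- x)) * f x - exp (- x) * p (exp (- x)) * f x)
        = \<bar>q (exp (- x)) - p (exp (- x))\<bar> * (exp (- x) * f x)"
        using one_sided_laplaceD(2)[OF f, of x]
        by (simp add: abs_mult flip: left_diff_distrib right_diff_distrib)
      also have "\<dots> \<le> e * (exp (- x) * f x)"
        using e[of "exp (- x)"] False one_sided_laplaceD(2)[OF f, of x] by (intro mult_right_mono) auto
      finally show ?thesis by simp
    qed
  qed
  finally show ?thesis by simp
qed

text \<open>
  For polynomial \<open>q\<close> the weighted integral only sees the Laplace transform at the positive integers.
\<close>

lemma exp_weight_integral_polynomial:
  assumes f: "one_sided_laplace f"
  shows "(\<integral>x. exp (- x) * (\<Sum>k\<le>n. a k * exp (- x) ^ k) * f x \<partial>lborel)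
    = (\<Sum>k\<le>n. a k * (\<integral>x. exp (- real (Suc k) * x) * f x \<partial>lborel))"
proof -
  have "exp (- x) * (\<Sum>k\<le>n. a k * exp (- x) ^ k) * f x
      = (\<Sum>k\<le>n. a k * (exp (- real (Suc k) * x) * f x))" for x
    unfolding sum_distrib_left sum_distrib_right
  proof (rule sum.cong)
    fix k
    have "exp (- real (Suc k) * x) = exp (- x) * exp (- x) ^ k"
      unfolding exp_of_nat_mult[symmetric] exp_add[symmetric] by (simp add: algebra_simps)
    then show "exp (- x) * (a k * exp (- x) ^ k) * f x = a k * (exp (- real (Suc k) * x) * f x)"
      by simp
  qed simp
  then have "(\<integral>x. exp (- x) * (\<Sum>k\<le>n. a k * exp (- x) ^ k) * f x \<partial>lborel)
    = (\<integral>x. (\<Sum>k\<le>n. a k * (exp (- real (Suc k) * x) * f x)) \<partial>lborel)"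
    by simp
  also have "\<dots> = (\<Sum>k\<le>n. (\<integral>x. a k * (exp (- real (Suc k) * x) * f x) \<partial>lborel))"
    by (intro Bochner_Integration.integral_sum integrable_mult_right one_sided_laplaceD(4)[OF f]) simp
  finally show ?thesis by simp
qed

text \<open>
  Karamata's approximation argument: the claim holds for polynomial \<open>q\<close> by linearity, and every
  continuous \<open>q\<close> is uniformly approximated by polynomials on \<open>[0, 1]\<close> (Weierstrass), at a cost
  controlled by the Laplace transforms at \<open>1\<close>, which converge and so stay bounded.
\<close>

lemma tendsto_exp_weight_integral:
  fixes G :: "'i \<Rightarrow> real \<Rightarrow> real" and g q :: "real \<Rightarrow> real"
  assumes G: "\<forall>\<^sub>F i in F. one_sided_laplace (G i)" and g: "one_sided_laplace g"
    and lim: "\<And>l. 0 < l \<Longrightarrow>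
      ((\<lambda>i. \<integral>x. exp (- l * x) * G i x \<partial>lborel) \<longlongrightarrow> (\<integral>x. exp (- l * x) * g x \<partial>lborel)) F"
    and q: "continuous_on UNIV q"
  shows "((\<lambda>i. \<integral>x. exp (- x) * q (exp (- x)) * G i x \<partial>lborel)
    \<longlongrightarrow> (\<integral>x. exp (- x) * q (exp (- x)) * g x \<partial>lborel)) F"
proof (rule tendstoI)
  fix d :: real assume d: "0 < d"
  define I where "I = (\<lambda>f. \<integral>x. exp (- 1 * x) * f x \<partial>lborel :: real)"
  define Q where "Q = (\<lambda>(q::real\<Rightarrow>real) f. \<integral>x. exp (- x) * q (exp (- x)) * f x \<partial>lborel :: real)"
  have I0: "0 \<le> I g"
    unfolding I_def using one_sided_laplaceD(2)[OF g] by (intro integral_nonneg_AE) auto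
  define e where "e = d / (2 * I g + 3)"
  (* Three errors will arise: at most e * (I g + 1) from approximating q under G i, at most e from the
     polynomial, at most e * I g from approximating q under g. Their sum stays below d. *)
  have e: "0 < e" "e * (2 * I g + 3) = d"
    using d I0 by (auto simp: e_def)
  obtain p where p: "real_polynomial_function p" "\<And>y. y \<in> {0..1} \<Longrightarrow> \<bar>q y - p y\<bar> < e"
    using Stone_Weierstrass_real_polynomial_function[of "{0..1::real}" q e] e
      continuous_on_subset[OF q] by auto
  obtain a n where p_eq: "p = (\<lambda>x. \<Sum>k\<le>n. a k * x ^ k)"
    using p(1) real_polynomial_function_iff_sum by auto
  have pc: "continuous_on UNIV p"
    unfolding p_eq by (intro continuous_intros)
  have "((\<lambda>i. \<Sum>k\<le>n. a k * (\<integral>x. exp (- real (Suc k) * x) * G i x \<partial>lborel))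
      \<longlongrightarrow> (\<Sum>k\<le>n. a k * (\<integral>x. exp (- real (Suc k) * x) * g x \<partial>lborel))) F"
    by (intro tendsto_intros lim) auto
  then have "\<forall>\<^sub>F i in F. dist (\<Sum>k\<le>n. a k * (\<integral>x. exp (- real (Suc k) * x) * G i x \<partial>lborel))
      (\<Sum>k\<le>n. a k * (\<integral>x. exp (- real (Suc k) * x) * g x \<partial>lborel)) < e"
    using e by (intro tendstoD) auto
  moreover have "\<forall>\<^sub>F i in F. I (G i) < I g + 1"
    unfolding I_def using lim[of 1] by (intro order_tendstoD) auto
  ultimately show "\<forall>\<^sub>F i in F. dist (\<integral>x. exp (- x) * q (exp (- x)) * G i x \<partial>lborel)
      (\<integral>x. exp (- x) * q (exp (- x)) * g x \<partial>lborel) < d"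
    using G
  proof eventually_elim
    case (elim i)
    have "\<bar>Q q (G i) - Q p (G i)\<bar> \<le> e * I (G i)" "\<bar>Q q g - Q p g\<bar> \<le> e * I g"
      unfolding I_def Q_def
      by (intro exp_weight_integral_diff_le g elim(3) pc q less_imp_le[OF p(2)]; assumption)+
    moreover have "\<bar>Q p (G i) - Q p g\<bar> < e"
      using elim(1) unfolding Q_def p_eq exp_weight_integral_polynomial[OF elim(3)]
        exp_weight_integral_polynomial[OF g] by (simp add: dist_real_def)
    moreover have "e * I (G i) \<le> e * (I g + 1)"
      using elim(2) e by (intro mult_left_mono) auto
    moreover have "e * (2 * I g + 3) = e * I g + e * (I g + 1) + 2 * e"
      by (simp add: algebra_simps)
    ultimately have "\<bar>Q q (G i) - Q q g\<bar> < d" using e by linarith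
    then show ?case by (simp add: Q_def dist_real_def)
  qed
qed

text \<open>
  The test functions for the Tauberian lemma: bumps supported in \<open>[u, v]\<close> that are \<open>exp (- x)\<close> times a
  continuous function of \<open>exp (- x)\<close>. The factor \<open>q\<close> is the positive part of a parabola with roots
  \<open>exp (- v)\<close> and \<open>exp (- u)\<close>.
\<close>

lemma exp_bump:
  fixes u v :: real
  assumes "0 < u" "u < v"
  obtains q :: "real \<Rightarrow> real" where "continuous_on UNIV q" "\<And>y. 0 \<le> q y"
    "\<And>x. x \<notin> {u<..<v} \<Longrightarrow> q (exp (- x)) = 0"
    "integrable lborel (\<lambda>x. exp (- x) * q (exp (- x)))"
    "0 < (\<integral>x. exp (- x) * q (exp (- x)) \<partial>lborel)"
proof
  define q :: "real \<Rightarrow> real" where "q = (\<lambda>y. max 0 ((y - exp (- v)) * (exp (- u) - y)))"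
  show qc: "continuous_on UNIV q" unfolding q_def by (intro continuous_intros)
  show q0: "0 \<le> q y" for y by (simp add: q_def)
  show qz: "q (exp (- x)) = 0" if "x \<notin> {u<..<v}" for x
    using that assms by (auto simp: q_def max_def mult_le_0_iff zero_le_mult_iff not_less not_le)
  have qpos: "0 < q (exp (- x))" if "x \<in> {u<..<v}" for x
    using that by (auto simp: q_def less_max_iff_disj)
  have [measurable]: "q \<in> borel_measurable borel"
    using qc by (rule borel_measurable_continuous_onI)
  have eq: "exp (- x) * q (exp (- x)) = indicator {u..v} x *\<^sub>R (exp (- x) * q (exp (- x)))" for x
    using qz[of x] by (cases "x \<in> {u<..<v}") auto
  have "integrable lborel (\<lambda>x. indicator {u..v} x *\<^sub>R (exp (- x) * q (exp (- x))))"
    by (rule borel_integrable_compact) (auto intro!: continuous_intros continuous_on_compose2[OF qc])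
  then show int: "integrable lborel (\<lambda>x. exp (- x) * q (exp (- x)))"
    by (rule iffD2[OF Bochner_Integration.integrable_cong[OF refl eq]])
  show "0 < (\<integral>x. exp (- x) * q (exp (- x)) \<partial>lborel)"
  proof (rule ccontr)
    assume "\<not> ?thesis"
    moreover have "0 \<le> (\<integral>x. exp (- x) * q (exp (- x)) \<partial>lborel)"
      using q0 by (intro integral_nonneg_AE) auto
    ultimately have "(\<integral>x. exp (- x) * q (exp (- x)) \<partial>lborel) = 0" by simp
    then have "AE x in lborel. exp (- x) * q (exp (- x)) = 0"
      using integral_nonneg_eq_0_iff_AE[OF int] q0 by simp
    then have "AE x in lborel. x \<notin> {u<..<v}"
      by eventually_elim (use qpos in force)
    then have "emeasure lborel {x \<in> space lborel. \<not> x \<notin> {u<..<v}} = 0"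
      by (subst (asm) AE_iff_measurable[OF _ refl]) auto
    then have "emeasure lborel {u<..<v} = 0" by (simp add: greaterThanLessThan_def greaterThan_def lessThan_def Collect_conj_eq)
    then show False using assms by simp
  qed
qed

text \<open>
  Testing against a bump supported just to the right of \<open>x0\<close> bounds \<open>G i x0\<close> from above: by
  monotonicity \<open>G i x0\<close> is at most the bump average of \<open>G i\<close>, which tends to the bump average of
  \<open>g\<close>, and the latter is close to \<open>g x0\<close> by continuity. A bump to the left bounds it from below.
\<close>

lemma tendsto_of_tendsto_laplace:
  fixes G :: "'i \<Rightarrow> real \<Rightarrow> real" and g :: "real \<Rightarrow> real"
  assumes G: "\<forall>\<^sub>F i in F. one_sided_laplace (G i) \<and> mono (G i)"
    and g: "one_sided_laplace g"
    and lim: "\<And>l. 0 < l \<Longrightarrow>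
      ((\<lambda>i. \<integral>x. exp (- l * x) * G i x \<partial>lborel) \<longlongrightarrow> (\<integral>x. exp (- l * x) * g x \<partial>lborel)) F"
    and x0: "0 < x0" and cont: "isCont g x0"
  shows "((\<lambda>i. G i x0) \<longlongrightarrow> g x0) F"
proof -
  have nonneg: "\<forall>\<^sub>F i in F. one_sided_laplace (G i)"
    using G by eventually_elim simp
  have conv: "((\<lambda>i. \<integral>x. exp (- x) * q (exp (- x)) * G i x \<partial>lborel)
      \<longlongrightarrow> (\<integral>x. exp (- x) * q (exp (- x)) * g x \<partial>lborel)) F"
    if "continuous_on UNIV q" for q
    using nonneg g lim that by (rule tendsto_exp_weight_integral)
  have near: "\<exists>\<eta>>0. \<eta> < x0 \<and> (\<forall>x. \<bar>x - x0\<bar> < \<eta> \<longrightarrow> \<bar>g x - g x0\<bar> < e)" if "0 < e" for e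
  proof -
    from cont that obtain s where s: "0 < s" "\<And>x. \<bar>x - x0\<bar> < s \<Longrightarrow> \<bar>g x - g x0\<bar> < e"
      unfolding continuous_at_eps_delta dist_real_def by blast
    then show ?thesis using x0 by (intro exI[of _ "min s (x0/2)"]) auto
  qed
  show ?thesis
  proof (rule order_tendstoI)
    fix c assume c: "g x0 < c"
    obtain \<eta> where \<eta>: "0 < \<eta>" "\<And>x. \<bar>x - x0\<bar> < \<eta> \<Longrightarrow> \<bar>g x - g x0\<bar> < (c - g x0) / 2"
      using near[of "(c - g x0) / 2"] c by auto
    obtain q where q: "continuous_on UNIV q" "\<And>y. 0 \<le> q y"
        "\<And>x. x \<notin> {x0<..<x0+\<eta>} \<Longrightarrow> q (exp (- x)) = 0"
        "integrable lborel (\<lambda>x. exp (- x) * q (exp (- x)))"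
        "0 < (\<integral>x. exp (- x) * q (exp (- x)) \<partial>lborel)" (is "0 < ?m")
      using exp_bump[of x0 "x0 + \<eta>"] x0 \<eta> by auto
    have "(\<integral>x. exp (- x) * q (exp (- x)) * g x \<partial>lborel)
        \<le> (\<integral>x. exp (- x) * q (exp (- x)) * ((c + g x0) / 2) \<partial>lborel)"
    proof (rule integral_mono)
      fix x
      show "exp (- x) * q (exp (- x)) * g x \<le> exp (- x) * q (exp (- x)) * ((c + g x0) / 2)"
      proof (cases "x \<in> {x0<..<x0+\<eta>}")
        case True
        then have "\<bar>g x - g x0\<bar> < (c - g x0) / 2" by (intro \<eta>(2)) auto
        then have "g x \<le> (c + g x0) / 2" by argo
        then show ?thesis using q(2) by (intro mult_left_mono) auto
      qed (simp add: q(3))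
    qed (use integrable_exp_weight[OF g q(1)] q(4) in auto)
    also have "\<dots> = ?m * ((c + g x0) / 2)" by simp
    also have "\<dots> < ?m * c" using q(5) c by (intro mult_strict_left_mono) auto
    finally have "\<forall>\<^sub>F i in F. (\<integral>x. exp (- x) * q (exp (- x)) * G i x \<partial>lborel) < ?m * c"
      by (rule order_tendstoD(2)[OF conv[OF q(1)]])
    then show "\<forall>\<^sub>F i in F. G i x0 < c"
      using G
    proof eventually_elim
      case (elim i)
      have "?m * G i x0 = (\<integral>x. exp (- x) * q (exp (- x)) * G i x0 \<partial>lborel)" by simp
      also have "\<dots> \<le> (\<integral>x. exp (- x) * q (exp (- x)) * G i x \<partial>lborel)"
      proof (rule integral_mono)
        fix x
        show "exp (- x) * q (exp (- x)) * G i x0 \<le> exp (- x) * q (exp (- x)) * G i x"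
        proof (cases "x \<in> {x0<..<x0+\<eta>}")
          case True
          then have "G i x0 \<le> G i x" using elim(2) by (auto intro: monoD)
          then show ?thesis using q(2) by (intro mult_left_mono) auto
        qed (simp add: q(3))
      qed (use elim integrable_exp_weight[of "G i", OF _ q(1)] q(4) in auto)
      finally have "?m * G i x0 < ?m * c" using elim(1) by linarith
      then show ?case using q(5) by simp
    qed
  next
    fix c assume c: "c < g x0"
    obtain \<eta> where \<eta>: "0 < \<eta>" "\<eta> < x0" "\<And>x. \<bar>x - x0\<bar> < \<eta> \<Longrightarrow> \<bar>g x - g x0\<bar> < (g x0 - c) / 2"
      using near[of "(g x0 - c) / 2"] c by auto
    obtain q where q: "continuous_on UNIV q" "\<And>y. 0 \<le> q y"
        "\<And>x. x \<notin> {x0-\<eta><..<x0} \<Longrightarrow> q (exp (- x)) = 0"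
        "integrable lborel (\<lambda>x. exp (- x) * q (exp (- x)))"
        "0 < (\<integral>x. exp (- x) * q (exp (- x)) \<partial>lborel)" (is "0 < ?m")
      using exp_bump[of "x0 - \<eta>" x0] x0 \<eta> by auto
    have "?m * c < ?m * ((c + g x0) / 2)" using q(5) c by (intro mult_strict_left_mono) auto
    also have "\<dots> = (\<integral>x. exp (- x) * q (exp (- x)) * ((c + g x0) / 2) \<partial>lborel)" by simp
    also have "\<dots> \<le> (\<integral>x. exp (- x) * q (exp (- x)) * g x \<partial>lborel)"
    proof (rule integral_mono)
      fix x
      show "exp (- x) * q (exp (- x)) * ((c + g x0) / 2) \<le> exp (- x) * q (exp (- x)) * g x"
      proof (cases "x \<in> {x0-\<eta><..<x0}")
        case True
        then have "\<bar>g x - g x0\<bar> < (g x0 - c) / 2" by (intro \<eta>(3)) auto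
        then have "(c + g x0) / 2 \<le> g x" by argo
        then show ?thesis using q(2) by (intro mult_left_mono) auto
      qed (simp add: q(3))
    qed (use integrable_exp_weight[OF g q(1)] q(4) in auto)
    finally have "\<forall>\<^sub>F i in F. ?m * c < (\<integral>x. exp (- x) * q (exp (- x)) * G i x \<partial>lborel)"
      by (rule order_tendstoD(1)[OF conv[OF q(1)]])
    then show "\<forall>\<^sub>F i in F. c < G i x0"
      using G
    proof eventually_elim
      case (elim i)
      have "(\<integral>x. exp (- x) * q (exp (- x)) * G i x \<partial>lborel) \<le> (\<integral>x. exp (- x) * q (exp (- x)) * G i x0 \<partial>lborel)"
      proof (rule integral_mono)
        fix x
        show "exp (- x) * q (exp (- x)) * G i x \<le> exp (- x) * q (exp (- x)) * G i x0"
        proof (cases "x \<in> {x0-\<eta><..<x0}")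
          case True
          then have "G i x \<le> G i x0" using elim(2) by (auto intro: monoD)
          then show ?thesis using q(2) by (intro mult_left_mono) auto
        qed (simp add: q(3))
      qed (use elim integrable_exp_weight[of "G i", OF _ q(1)] q(4) in auto)
      also have "\<dots> = ?m * G i x0" by simp
      finally have "?m * c < ?m * G i x0" using elim(1) by linarith
      then show ?case using q(5) by simp
    qed
  qed
qed

section \<open>Gamma integrals and the layer-cake formula\<close>

text \<open>
  Euler's integral after the substitution \<open>u \<mapsto> l * u\<close>.
\<close>

lemma nn_integral_powr_exp:
  fixes a l :: real
  assumes a: "0 < a" and l: "0 < l"
  shows "(\<integral>\<^sup>+u. ennreal (u powr (a - 1) * exp (- l * u)) * indicator {0<..} u \<partial>lborel)
    = ennreal (Gamma a / l powr a)"
proof -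
  define f :: "real \<Rightarrow> ennreal" where
    "f = (\<lambda>u. ennreal (indicator {0..} u * u powr (a - 1) / exp u))"
  have [measurable]: "f \<in> borel_measurable borel" unfolding f_def by measurable
  have "ennreal (Gamma a) = (\<integral>\<^sup>+u. f u \<partial>lborel)"
    unfolding f_def by (rule Gamma_conv_nn_integral_real[OF a])
  also have "\<dots> = ennreal l * (\<integral>\<^sup>+u. f (l * u) \<partial>lborel)"
    using nn_integral_real_affine[of f l 0] l by simp
  also have "(\<lambda>u. f (l * u)) = (\<lambda>u. ennreal (l powr (a - 1)) *
      (ennreal (u powr (a - 1) * exp (- l * u)) * indicator {0<..} u))"
  proof
    fix u :: real
    consider "u < 0" | "u = 0" | "0 < u" by linarith
    then show "f (l * u) = ennreal (l powr (a - 1)) *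
      (ennreal (u powr (a - 1) * exp (- l * u)) * indicator {0<..} u)"
    proof cases
      case 1
      then have "l * u < 0" using l by (simp add: mult_pos_neg)
      then show ?thesis using 1 by (simp add: f_def)
    next
      case 3
      then show ?thesis using l
        by (simp add: f_def powr_mult exp_minus divide_inverse mult_ac flip: ennreal_mult')
    qed (simp add: f_def)
  qed
  also have "ennreal l * (\<integral>\<^sup>+u. ennreal (l powr (a - 1)) *
      (ennreal (u powr (a - 1) * exp (- l * u)) * indicator {0<..} u) \<partial>lborel)
    = ennreal (l powr a) * (\<integral>\<^sup>+u. ennreal (u powr (a - 1) * exp (- l * u)) * indicator {0<..} u \<partial>lborel)"
    using l by (subst nn_integral_cmult) (auto simp: mult.assoc[symmetric] powr_diff simp flip: ennreal_mult')
  finally have eq: "ennreal (Gamma a) = ennreal (l powr a) *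
    (\<integral>\<^sup>+u. ennreal (u powr (a - 1) * exp (- l * u)) * indicator {0<..} u \<partial>lborel)" .
  have "ennreal (Gamma a / l powr a) = ennreal (Gamma a) / ennreal (l powr a)"
    using l a by (intro divide_ennreal[symmetric]) (auto simp: Gamma_real_nonneg)
  also have "\<dots> = (\<integral>\<^sup>+u. ennreal (u powr (a - 1) * exp (- l * u)) * indicator {0<..} u \<partial>lborel)"
    unfolding eq using l by (subst mult.commute, subst ennreal_mult_divide_eq) auto
  finally show ?thesis by simp
qed

lemma has_bochner_integral_exp_powr:
  fixes a l :: real
  assumes a: "0 < a" and l: "0 < l"
  shows "has_bochner_integral lborel (\<lambda>x. exp (- l * x) * max 0 x powr a)
    (Gamma (a + 1) / l powr (a + 1))"
proof (rule has_bochner_integral_nn_integral)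
  have "(\<integral>\<^sup>+x. ennreal (exp (- l * x) * max 0 x powr a) \<partial>lborel)
    = (\<integral>\<^sup>+u. ennreal (u powr (a + 1 - 1) * exp (- l * u)) * indicator {0<..} u \<partial>lborel)"
    by (intro nn_integral_cong) (auto simp: indicator_def max_def mult.commute)
  also have "\<dots> = ennreal (Gamma (a + 1) / l powr (a + 1))"
    using a l by (intro nn_integral_powr_exp) auto
  finally show "(\<integral>\<^sup>+x. ennreal (exp (- l * x) * max 0 x powr a) \<partial>lborel)
    = ennreal (Gamma (a + 1) / l powr (a + 1))" .
qed (use a in \<open>auto intro: Gamma_real_nonneg\<close>)

lemma one_sided_laplace_powr:
  assumes "0 < a" "0 \<le> c"
  shows "one_sided_laplace (\<lambda>x. c * max 0 x powr a)"
  using assms has_bochner_integral_exp_powr[OF assms(1), THEN integrable.intros]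
  by (auto simp: one_sided_laplace_def mult.left_commute[of _ c])

lemma nn_integral_exp_greaterThan:
  fixes s d :: real
  assumes s: "0 < s"
  shows "(\<integral>\<^sup>+t. ennreal (exp (- s * t)) * indicator {d<..} t \<partial>lborel) = ennreal (exp (- s * d) / s)"
proof -
  have "(\<integral>\<^sup>+t. ennreal (exp (- s * t)) * indicator {d<..} t \<partial>lborel)
     = (\<integral>\<^sup>+t. ennreal (exp (- s * (d + 1 * t))) * indicator {d<..} (d + 1 * t) \<partial>lborel)"
    by (subst nn_integral_real_affine[of _ 1 d]) auto
  also have "\<dots> = (\<integral>\<^sup>+t. ennreal (exp (- s * d)) * (ennreal (t powr (1 - 1) * exp (- s * t)) * indicator {0<..} t) \<partial>lborel)"
    by (intro nn_integral_cong) (auto simp: indicator_def algebra_simps exp_add[symmetric] exp_minus_inverse simp flip: ennreal_mult')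
  also have "\<dots> = ennreal (exp (- s * d)) * ennreal (Gamma 1 / s powr 1)"
    by (subst nn_integral_cmult) (use nn_integral_powr_exp[of 1 s] s in auto)
  also have "\<dots> = ennreal (exp (- s * d) / s)"
    using s by (simp flip: ennreal_mult')
  finally show ?thesis .
qed

text \<open>
  This turns moments of the inverse process into integrals of the events \<open>E\<^sub>t > u\<close>, which are
  statements about the subordinator itself.
\<close>

lemma ennreal_powr_layer_cake:
  assumes p: "0 < p"
  shows "ennreal_powr x p
    = (\<integral>\<^sup>+u. ennreal (p * u powr (p - 1)) * indicator {0<..} u * indicator {u. ennreal u < x} u \<partial>lborel)"
proof -
  have fin: "(\<integral>\<^sup>+u. ennreal (p * u powr (p - 1)) * indicator {0..r} u \<partial>lborel) = ennreal (r powr p)"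
    if "0 \<le> r" for r
  proof -
    have "((\<lambda>u. p * u powr (p - 1)) has_integral p * (r powr (p - 1 + 1) / (p - 1 + 1))) {0..r}"
      using p that by (intro has_integral_mult_right has_integral_powr_from_0) auto
    then show ?thesis
      using p by (subst nn_integral_has_integral_lebesgue'[of "{0..r}" _ "r powr p"]) auto
  qed
  show ?thesis
  proof (cases x)
    case (real r)
    have "(\<integral>\<^sup>+u. ennreal (p * u powr (p - 1)) * indicator {0<..} u * indicator {u. ennreal u < x} u \<partial>lborel)
      = (\<integral>\<^sup>+u. ennreal (p * u powr (p - 1)) * indicator {0..r} u \<partial>lborel)"
    proof (rule nn_integral_cong_AE)
      have "AE u in lborel. u \<noteq> 0 \<and> u \<noteq> r" using AE_lborel_singleton[of 0] AE_lborel_singleton[of r] by simp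
      then show "AE u in lborel. ennreal (p * u powr (p - 1)) * indicator {0<..} u * indicator {u. ennreal u < x} u
        = ennreal (p * u powr (p - 1)) * indicator {0..r} u"
        by eventually_elim (use real in \<open>auto simp: indicator_def ennreal_less_iff\<close>)
    qed
    with fin[of r] real show ?thesis by (simp add: ennreal_powr_def)
  next
    case top
    let ?I = "\<integral>\<^sup>+u. ennreal (p * u powr (p - 1)) * indicator {0<..} u \<partial>lborel"
    have "ennreal (of_nat n) \<le> ?I" for n :: nat
    proof -
      have "ennreal (of_nat n) = (\<integral>\<^sup>+u. ennreal (p * u powr (p - 1)) * indicator {0..real n powr (1/p)} u \<partial>lborel)"
        using p by (subst fin) (auto simp: powr_powr)
      also have "\<dots> \<le> ?I"
        by (intro nn_integral_mono) (auto simp: indicator_def)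
      finally show ?thesis .
    qed
    then have "\<not> ?I < \<top>"
      using ennreal_Ex_less_of_nat[of ?I] by (auto simp: ennreal_of_nat_eq_real_of_nat not_less[symmetric])
    then have "?I = \<top>" using top.not_eq_extremum by blast
    with top show ?thesis by (simp add: ennreal_powr_def)
  qed
qed

section \<open>The inverse of a subordinator and the Laplace transform of its moments\<close>

text \<open>
  The infimum defining the inverse process runs over uncountably many times, so that its measurability
  is not evident. Restricting it to the rationals gives a function that is jointly measurable in time
  and chance, hence usable in Tonelli's theorem, and that agrees with the inverse process along
  strictly increasing paths. The value \<open>\<top>\<close> for times not yet past \<open>t\<close> keeps the countable index set
  independent of the path.
\<close>

definition rational_inverse :: "(real \<Rightarrow> 'a \<Rightarrow> real) \<Rightarrow> real \<Rightarrow> 'a \<Rightarrow> ennreal" where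
  "rational_inverse D t \<omega> = (INF u\<in>{u\<in>\<rat>. 0 < u}. if t < D u \<omega> then ennreal u else \<top>)"

lemma rational_inverse_mono: "s \<le> t \<Longrightarrow> rational_inverse D s \<omega> \<le> rational_inverse D t \<omega>"
  unfolding rational_inverse_def by (intro INF_mono) force

lemma rational_inverse_eq:
  assumes mono: "strict_mono_on {0..} (\<lambda>t. D t \<omega>)"
  shows "rational_inverse D t \<omega> = inverse_process D t \<omega>"
proof (rule antisym)
  show "inverse_process D t \<omega> \<le> rational_inverse D t \<omega>"
    unfolding rational_inverse_def inverse_process_def
    by (intro INF_greatest) (auto intro!: INF_lower)
  show "rational_inverse D t \<omega> \<le> inverse_process D t \<omega>"
    unfolding inverse_process_def
  proof (rule INF_greatest, clarify)
    fix v assume v: "0 < v" "t < D v \<omega>"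
    show "rational_inverse D t \<omega> \<le> ennreal v"
    proof (rule ennreal_le_epsilon)
      fix e :: real assume "0 < e"
      then obtain u where u: "u \<in> \<rat>" "v < u" "u < v + e"
        using Rats_dense_in_real[of v "v + e"] by auto
      then have "t < D u \<omega>"
        using strict_mono_onD[OF mono, of v u] v by auto
      then have "rational_inverse D t \<omega> \<le> ennreal u"
        unfolding rational_inverse_def using u v by (intro INF_lower2[of u]) auto
      also have "\<dots> \<le> ennreal v + ennreal e"
        using u v \<open>0 < e\<close> by (simp flip: ennreal_plus)
      finally show "rational_inverse D t \<omega> \<le> ennreal v + ennreal e" .
    qed
  qed
qed

text \<open>
  Right-continuity yields the implication from right to left: if the path is below \<open>t\<close> at time \<open>u\<close>,
  it remains below for some time after. Conversely, if the path has reached \<open>t\<close> at time \<open>u\<close>,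
  strict monotonicity puts it above \<open>t\<close> at all later times.
\<close>

lemma less_inverse_process_iff:
  assumes mono: "strict_mono_on {0..} (\<lambda>t. D t \<omega>)"
    and rc: "((\<lambda>t. D t \<omega>) \<longlongrightarrow> D u \<omega>) (at_right u)" and u: "0 \<le> u"
  shows "ennreal u < inverse_process D t \<omega> \<longleftrightarrow> D u \<omega> < t"
proof
  assume less: "ennreal u < inverse_process D t \<omega>"
  show "D u \<omega> < t"
  proof (rule ccontr)
    assume "\<not> D u \<omega> < t"
    then have *: "t < D v \<omega>" if "u < v" for v
      using strict_mono_onD[OF mono, of u v] that u by auto
    have "inverse_process D t \<omega> \<le> ennreal u"
    proof (rule ennreal_le_epsilon)
      fix e :: real assume e: "0 < e"
      have "inverse_process D t \<omega> \<le> ennreal (u + e)"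
        unfolding inverse_process_def using u e *[of "u + e"] by (intro INF_lower) auto
      then show "inverse_process D t \<omega> \<le> ennreal u + ennreal e"
        using u e by simp
    qed
    with less show False by simp
  qed
next
  assume less: "D u \<omega> < t"
  from rc less have "\<forall>\<^sub>F v in at_right u. D v \<omega> < t"
    by (rule order_tendstoD)
  then obtain b where b: "u < b" "\<And>v. u < v \<Longrightarrow> v < b \<Longrightarrow> D v \<omega> < t"
    unfolding eventually_at_right_field by blast
  have "ennreal u < ennreal ((u + b) / 2)" using u b by (simp add: ennreal_less_iff)
  also have "\<dots> \<le> inverse_process D t \<omega>"
    unfolding inverse_process_def
  proof (rule INF_greatest, clarify)
    fix v assume v: "0 < v" "t < D v \<omega>"
    have "(u + b) / 2 \<le> v"
    proof (rule ccontr)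
      assume "\<not> (u + b) / 2 \<le> v"
      then have "D v \<omega> < D ((u + b) / 2) \<omega>" using strict_mono_onD[OF mono, of v "(u+b)/2"] v by auto
      also have "\<dots> < t" using b by auto
      finally show False using v by simp
    qed
    then show "ennreal ((u + b) / 2) \<le> ennreal v" by (rule ennreal_leI)
  qed
  finally show "ennreal u < inverse_process D t \<omega>" .
qed

lemma ennreal_powr_mono:
  assumes "x \<le> y" "0 \<le> p"
  shows "ennreal_powr x p \<le> ennreal_powr y p"
  using assms by (auto simp: ennreal_powr_def less_top top_unique
    intro!: ennreal_leI powr_mono2 enn2real_mono)

lemma borel_measurable_ennreal_powr [measurable (raw)]:
  assumes [measurable]: "f \<in> borel_measurable N"
  shows "(\<lambda>x. ennreal_powr (f x) p) \<in> borel_measurable N"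
  unfolding ennreal_powr_def by measurable

context subordinator
begin

lemma AE_regular_paths:
  "AE \<omega> in M. D 0 \<omega> = 0 \<and> strict_mono_on {0..} (\<lambda>t. D t \<omega>) \<and>
     (\<forall>u\<ge>0. ((\<lambda>t. D t \<omega>) \<longlongrightarrow> D u \<omega>) (at_right u))"
  using D_zero strictly_increasing_paths cadlag_paths
  by eventually_elim (auto simp: cadlag_on_nonneg_def)

lemma borel_measurable_rational_inverse [measurable]:
  "(\<lambda>(t, \<omega>). rational_inverse D t \<omega>) \<in> borel_measurable (borel \<Otimes>\<^sub>M M)"
proof -
  have "(\<lambda>z. INF u\<in>{u\<in>\<rat>. 0 < u}. if fst z < D u (snd z) then ennreal u else \<top>)
    \<in> borel_measurable (borel \<Otimes>\<^sub>M M)"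
  proof (intro borel_measurable_INF)
    show "countable {u \<in> \<rat>. 0 < (u::real)}" using countable_rat by (rule countable_subset[rotated]) auto
    fix u :: real assume "u \<in> {u \<in> \<rat>. 0 < u}"
    then have [measurable]: "D u \<in> borel_measurable M" using random_variable_D by auto
    show "(\<lambda>z. if fst z < D u (snd z) then ennreal u else \<top>) \<in> borel_measurable (borel \<Otimes>\<^sub>M M)"
      by measurable
  qed
  then show ?thesis by (simp add: rational_inverse_def case_prod_unfold)
qed

definition inverse_moment :: "real \<Rightarrow> real \<Rightarrow> ennreal" where
  "inverse_moment p t = (\<integral>\<^sup>+\<omega>. ennreal_powr (rational_inverse D t \<omega>) p \<partial>M)"

lemma borel_measurable_inverse_moment [measurable]: "inverse_moment p \<in> borel_measurable borel"
proof -
  have "(\<lambda>t. \<integral>\<^sup>+\<omega>. ennreal_powr ((\<lambda>(t, \<omega>). rational_inverse D t \<omega>) (t, \<omega>)) p \<partial>M) \<in> borel_measurable borel"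
    by measurable
  then show ?thesis by (simp add: inverse_moment_def[abs_def])
qed

lemma mono_inverse_moment: "0 \<le> p \<Longrightarrow> mono (inverse_moment p)"
  unfolding inverse_moment_def
  by (intro monoI nn_integral_mono ennreal_powr_mono rational_inverse_mono)

lemma inverse_moment_eq:
  "inverse_moment p t = (\<integral>\<^sup>+\<omega>. ennreal_powr (inverse_process D t \<omega>) p \<partial>M)"
  unfolding inverse_moment_def using AE_regular_paths
  by (intro nn_integral_cong_AE, eventually_elim) (simp add: rational_inverse_eq)

lemma AE_inverse_process_nonpos:
  assumes "t \<le> 0"
  shows "AE \<omega> in M. inverse_process D t \<omega> = 0"
  using AE_regular_paths
proof eventually_elim
  case (elim \<omega>)
  have "\<not> ennreal 0 < inverse_process D t \<omega>"
    using elim assms by (subst less_inverse_process_iff) auto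
  then show ?case by simp
qed

lemma inverse_moment_nonpos:
  assumes "0 < p" "t \<le> 0"
  shows "inverse_moment p t = 0"
proof -
  have "inverse_moment p t = (\<integral>\<^sup>+\<omega>. 0 \<partial>M)"
    unfolding inverse_moment_eq using AE_inverse_process_nonpos[OF assms(2)]
    by (intro nn_integral_cong_AE, eventually_elim) (simp add: ennreal_powr_def)
  then show ?thesis by simp
qed

lemma nn_integral_laplace_subordinator:
  assumes "0 < s" "0 \<le> u"
  shows "(\<integral>\<^sup>+\<omega>. ennreal (exp (- s * D u \<omega>)) \<partial>M) = ennreal (exp (- u * laplace_exponent \<nu> s))"
proof -
  have [measurable]: "D u \<in> borel_measurable M" using random_variable_D assms by auto
  have "AE \<omega> in M. exp (- s * D u \<omega>) \<le> 1"
    using AE_regular_paths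
  proof eventually_elim
    case (elim \<omega>)
    then have "0 \<le> D u \<omega>" using strict_mono_on_leD[of "{0..}" "\<lambda>t. D t \<omega>" 0 u] assms by auto
    then show ?case using assms by simp
  qed
  then have "integrable M (\<lambda>\<omega>. exp (- s * D u \<omega>))"
    by (intro integrable_const_bound[of _ 1]) auto
  then show ?thesis
    using laplace_transform[OF assms] by (subst nn_integral_eq_integral) auto
qed

text \<open>
  By the layer-cake formula the left-hand side is a triple integral over \<open>t\<close>, \<open>\<omega>\<close> and the level \<open>u\<close>.
  Almost surely \<open>u < E\<^sub>t\<close> means \<open>D\<^sub>u < t\<close>, so integrating over \<open>t\<close> first gives \<open>exp (- s * D\<^sub>u) / s\<close>,
  taking expectations gives \<open>exp (- u * \<phi> s) / s\<close>, and the remaining integral over \<open>u\<close> is a Gamma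
  integral.
\<close>

lemma laplace_inverse_moment:
  assumes p: "0 < p" and s: "0 < s" and phi: "0 < laplace_exponent \<nu> s"
  shows "(\<integral>\<^sup>+t. ennreal (exp (- s * t)) * inverse_moment p t \<partial>lborel)
    = ennreal (Gamma (p + 1) / (s * laplace_exponent \<nu> s powr p))"
proof -
  define E where "E = (\<lambda>(t, \<omega>). rational_inverse D t \<omega>)"
  have [measurable]: "E \<in> borel_measurable (borel \<Otimes>\<^sub>M M)" unfolding E_def by measurable
  define w where "w = (\<lambda>u::real. ennreal (p * u powr (p - 1)) * indicator {0<..} u)"
  have [measurable]: "w \<in> borel_measurable borel" unfolding w_def by measurable
  define a where "a = (\<lambda>t::real. ennreal (exp (- s * t)))"
  have [measurable]: "a \<in> borel_measurable borel" unfolding a_def by measurable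
  (* J t omega u is the indicator of u < E_t, written so that its joint measurability is immediate. *)
  define J where "J = (\<lambda>t \<omega> u. if ennreal u < E (t, \<omega>) then 1 else 0 :: ennreal)"
  have powr: "ennreal_powr (rational_inverse D t \<omega>) p = (\<integral>\<^sup>+u. w u * J t \<omega> u \<partial>lborel)" for t \<omega>
    unfolding w_def J_def E_def ennreal_powr_layer_cake[OF p]
    by (intro nn_integral_cong) (auto simp: indicator_def)
  interpret LM: pair_sigma_finite lborel M ..
  have "(\<integral>\<^sup>+t. a t * inverse_moment p t \<partial>lborel)
    = (\<integral>\<^sup>+t. \<integral>\<^sup>+\<omega>. \<integral>\<^sup>+u. a t * (w u * J t \<omega> u) \<partial>lborel \<partial>M \<partial>lborel)"
    unfolding inverse_moment_def powr J_def by (simp add: nn_integral_cmult)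
  also have "\<dots> = (\<integral>\<^sup>+t. \<integral>\<^sup>+u. \<integral>\<^sup>+\<omega>. a t * (w u * J t \<omega> u) \<partial>M \<partial>lborel \<partial>lborel)"
    unfolding J_def by (intro nn_integral_cong LM.Fubini') measurable
  also have "\<dots> = (\<integral>\<^sup>+u. \<integral>\<^sup>+t. \<integral>\<^sup>+\<omega>. a t * (w u * J t \<omega> u) \<partial>M \<partial>lborel \<partial>lborel)"
    unfolding J_def by (intro lborel_pair.Fubini'[symmetric]) measurable
  also have "\<dots> = (\<integral>\<^sup>+u. \<integral>\<^sup>+\<omega>. \<integral>\<^sup>+t. a t * (w u * J t \<omega> u) \<partial>lborel \<partial>M \<partial>lborel)"
    unfolding J_def by (intro nn_integral_cong LM.Fubini'[symmetric]) measurable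
  also have "\<dots> = (\<integral>\<^sup>+u. w u * (\<integral>\<^sup>+\<omega>. \<integral>\<^sup>+t. a t * J t \<omega> u \<partial>lborel \<partial>M) \<partial>lborel)"
  proof (intro nn_integral_cong)
    fix u :: real
    have [measurable]: "(\<lambda>t. J t \<omega> u) \<in> borel_measurable borel" if "\<omega> \<in> space M" for \<omega>
      unfolding J_def using that by measurable
    have "(\<integral>\<^sup>+\<omega>. \<integral>\<^sup>+t. a t * (w u * J t \<omega> u) \<partial>lborel \<partial>M)
      = (\<integral>\<^sup>+\<omega>. w u * (\<integral>\<^sup>+t. a t * J t \<omega> u \<partial>lborel) \<partial>M)"
      by (intro nn_integral_cong) (simp add: mult.left_commute[of "a _"] nn_integral_cmult)
    also have "\<dots> = w u * (\<integral>\<^sup>+\<omega>. \<integral>\<^sup>+t. a t * J t \<omega> u \<partial>lborel \<partial>M)"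
      unfolding J_def by (intro nn_integral_cmult) measurable
    finally show "(\<integral>\<^sup>+\<omega>. \<integral>\<^sup>+t. a t * (w u * J t \<omega> u) \<partial>lborel \<partial>M)
      = w u * (\<integral>\<^sup>+\<omega>. \<integral>\<^sup>+t. a t * J t \<omega> u \<partial>lborel \<partial>M)" .
  qed
  also have "\<dots> = (\<integral>\<^sup>+u. w u * ennreal (exp (- laplace_exponent \<nu> s * u) / s) \<partial>lborel)"
  proof (intro nn_integral_cong)
    fix u :: real
    show "w u * (\<integral>\<^sup>+\<omega>. \<integral>\<^sup>+t. a t * J t \<omega> u \<partial>lborel \<partial>M)
      = w u * ennreal (exp (- laplace_exponent \<nu> s * u) / s)"
    proof (cases "0 < u")
      case u: True
      then have [measurable]: "D u \<in> borel_measurable M" using random_variable_D by auto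
      have "(\<integral>\<^sup>+\<omega>. \<integral>\<^sup>+t. a t * J t \<omega> u \<partial>lborel \<partial>M) = (\<integral>\<^sup>+\<omega>. ennreal (exp (- s * D u \<omega>) / s) \<partial>M)"
        using AE_regular_paths
      proof (intro nn_integral_cong_AE, eventually_elim)
        case (elim \<omega>)
        have "J t \<omega> u = indicator {D u \<omega><..} t" for t
          unfolding J_def E_def using elim u
          by (auto simp: rational_inverse_eq less_inverse_process_iff)
        then show ?case
          using nn_integral_exp_greaterThan[OF s] by (simp add: a_def)
      qed
      also have "\<dots> = (\<integral>\<^sup>+\<omega>. ennreal (1 / s) * ennreal (exp (- s * D u \<omega>)) \<partial>M)"
        using s by (simp flip: ennreal_mult')
      also have "\<dots> = ennreal (1 / s) * ennreal (exp (- u * laplace_exponent \<nu> s))"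
        using nn_integral_laplace_subordinator[OF s, of u] u by (subst nn_integral_cmult) auto
      also have "\<dots> = ennreal (exp (- laplace_exponent \<nu> s * u) / s)"
        using s by (simp add: mult.commute flip: ennreal_mult')
      finally show ?thesis by simp
    qed (simp add: w_def)
  qed
  also have "\<dots> = (\<integral>\<^sup>+u. ennreal (p / s) *
      (ennreal (u powr (p - 1) * exp (- laplace_exponent \<nu> s * u)) * indicator {0<..} u) \<partial>lborel)"
    unfolding w_def using s p
    by (intro nn_integral_cong) (auto simp: indicator_def field_simps simp flip: ennreal_mult')
  also have "\<dots> = ennreal (p / s) * ennreal (Gamma p / laplace_exponent \<nu> s powr p)"
    using nn_integral_powr_exp[OF p phi] by (subst nn_integral_cmult) auto
  also have "\<dots> = ennreal (Gamma (p + 1) / (s * laplace_exponent \<nu> s powr p))"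
  proof -
    have "p \<notin> \<int>\<^sub>\<le>\<^sub>0" using p by (auto elim!: nonpos_Ints_cases)
    then have "p / s * (Gamma p / laplace_exponent \<nu> s powr p)
      = Gamma (p + 1) / (s * laplace_exponent \<nu> s powr p)"
      by (simp add: Gamma_plus1)
    then show ?thesis using s p by (simp flip: ennreal_mult')
  qed
  finally show ?thesis unfolding a_def .
qed

end

section \<open>Asymptotic equivalence and truncation\<close>

text \<open>
  The common gauge \<open>k\<close> reduces all the asymptotic equivalences in question to real limits.
\<close>

lemma ennreal_quotient_tendsto_1:
  fixes a b k :: "'i \<Rightarrow> real"
  assumes a: "((\<lambda>i. a i * k i) \<longlongrightarrow> c) F" and b: "((\<lambda>i. b i * k i) \<longlongrightarrow> c) F"
    and c: "0 < c" and nonneg: "\<And>i. 0 \<le> a i" "\<And>i. 0 \<le> b i"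
  shows "((\<lambda>i. ennreal (a i) / ennreal (b i)) \<longlongrightarrow> 1) F"
proof -
  have "((\<lambda>i. ennreal ((a i * k i) / (b i * k i))) \<longlongrightarrow> ennreal (c / c)) F"
    using a b c by (intro tendsto_intros) auto
  then have lim: "((\<lambda>i. ennreal ((a i * k i) / (b i * k i))) \<longlongrightarrow> 1) F"
    using c by simp
  have "\<forall>\<^sub>F i in F. 0 < b i * k i" using b c by (rule order_tendstoD)
  then have "\<forall>\<^sub>F i in F. ennreal ((a i * k i) / (b i * k i)) = ennreal (a i) / ennreal (b i)"
  proof eventually_elim
    case (elim i)
    then have "k i \<noteq> 0" "0 < b i" using nonneg(2)[of i] by (auto simp: zero_less_mult_iff)
    then show ?case using nonneg(1)[of i] by (simp add: divide_ennreal)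
  qed
  with lim show ?thesis by (rule Lim_transform_eventually)
qed

text \<open>
  Markov's trick: where \<open>x > d\<close>, the power \<open>x\<^sup>p\<close> is at most \<open>x\<^sup>p\<^sup>+\<^sup>1 / d\<close>. The truncation error of a moment
  is thus controlled by the next higher moment.
\<close>

lemma ennreal_powr_truncation_le:
  assumes p: "0 < p" and d: "0 < d"
  shows "ennreal_powr x p \<le> ennreal_powr x p * indicator {..ennreal d} x + ennreal (1 / d) * ennreal_powr x (p + 1)"
proof (cases "x \<le> ennreal d")
  case False
  show ?thesis
  proof (cases x)
    case (real r)
    then have r: "d < r" using False by (simp add: not_le ennreal_less_iff d less_imp_le)
    then have "r powr p * d \<le> r powr p * r" by (intro mult_left_mono) auto
    also have "\<dots> = r powr (p + 1)" using r d by (simp add: powr_add)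
    finally have "r powr p \<le> 1 / d * r powr (p + 1)" using d by (simp add: field_simps)
    then show ?thesis using real False d
      by (simp add: ennreal_powr_def flip: ennreal_mult')
  next
    case top
    then show ?thesis using d by (simp add: ennreal_powr_def ennreal_mult_top)
  qed
qed simp

lemma ennreal_sqrt_eq_powr: "ennreal_sqrt x = ennreal_powr x (1 / 2)"
  by (simp add: ennreal_sqrt_def ennreal_powr_def powr_half_sqrt)

context subordinator
begin

definition truncated_inverse_moment :: "real \<Rightarrow> real \<Rightarrow> real \<Rightarrow> ennreal" where
  "truncated_inverse_moment d p t =
     (\<integral>\<^sup>+\<omega>. ennreal_powr (rational_inverse D t \<omega>) p * indicator {..ennreal d} (rational_inverse D t \<omega>) \<partial>M)"

lemma truncated_inverse_moment_eq:
  "truncated_inverse_moment d p t =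
     (\<integral>\<^sup>+\<omega>. ennreal_powr (inverse_process D t \<omega>) p * indicator {..ennreal d} (inverse_process D t \<omega>) \<partial>M)"
  unfolding truncated_inverse_moment_def using AE_regular_paths
  by (intro nn_integral_cong_AE, eventually_elim) (simp add: rational_inverse_eq)

lemma truncated_inverse_moment_le: "truncated_inverse_moment d p t \<le> inverse_moment p t"
  unfolding truncated_inverse_moment_def inverse_moment_def
  by (intro nn_integral_mono) (auto simp: indicator_def)

lemma inverse_moment_truncation_le:
  assumes "0 < p" "0 < d"
  shows "inverse_moment p t \<le> truncated_inverse_moment d p t + ennreal (1 / d) * inverse_moment (p + 1) t"
proof -
  have "(\<lambda>\<omega>. (\<lambda>(t, \<omega>). rational_inverse D t \<omega>) (t, \<omega>)) \<in> borel_measurable M"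
    by measurable
  then have [measurable]: "rational_inverse D t \<in> borel_measurable M" by simp
  have "inverse_moment p t \<le> (\<integral>\<^sup>+\<omega>. ennreal_powr (rational_inverse D t \<omega>) p * indicator {..ennreal d} (rational_inverse D t \<omega>)
      + ennreal (1 / d) * ennreal_powr (rational_inverse D t \<omega>) (p + 1) \<partial>M)"
    unfolding inverse_moment_def by (intro nn_integral_mono ennreal_powr_truncation_le assms)
  also have "\<dots> = truncated_inverse_moment d p t + ennreal (1 / d) * inverse_moment (p + 1) t"
    unfolding inverse_moment_def truncated_inverse_moment_def
    by (simp add: nn_integral_add nn_integral_cmult)
  finally show ?thesis .
qed

text \<open>
  \<open>exp (- \<phi> s)\<close> is the expectation of \<open>exp (- s * D\<^sub>1)\<close>, which tends to \<open>0\<close> by dominated convergence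
  because \<open>D\<^sub>1 > 0\<close> almost surely.
\<close>

lemma laplace_exponent_at_top: "filterlim (laplace_exponent \<nu>) at_top at_top"
proof -
  have [measurable]: "D 1 \<in> borel_measurable M" using random_variable_D by auto
  have pos: "AE \<omega> in M. 0 < D 1 \<omega>"
    using AE_regular_paths
  proof eventually_elim
    case (elim \<omega>)
    then show ?case using strict_mono_onD[of "{0..}" "\<lambda>t. D t \<omega>" 0 1] by auto
  qed
  have "((\<lambda>s. \<integral>\<omega>. exp (- s * D 1 \<omega>) \<partial>M) \<longlongrightarrow> (\<integral>\<omega>. 0 \<partial>M)) at_top"
  proof (rule integral_dominated_convergence_at_top[where w="\<lambda>_. 1"])
    show "\<forall>\<^sub>F s in at_top. AE \<omega> in M. norm (exp (- s * D 1 \<omega>)) \<le> 1"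
      using eventually_ge_at_top[of 0]
    proof eventually_elim
      case (elim s)
      show ?case using pos by eventually_elim (use elim in simp)
    qed
    show "AE \<omega> in M. ((\<lambda>s. exp (- s * D 1 \<omega>)) \<longlongrightarrow> 0) at_top"
      using pos
    proof eventually_elim
      case (elim \<omega>)
      have "filterlim (\<lambda>s. s * D 1 \<omega>) at_top at_top"
        using elim by (intro filterlim_at_top_mult_tendsto_pos[OF tendsto_const]) (auto intro: filterlim_ident)
      then show ?case
        by (intro filterlim_compose[OF exp_at_bot]) (simp add: filterlim_uminus_at_bot)
    qed
  qed auto
  then have lim: "((\<lambda>s. \<integral>\<omega>. exp (- s * D 1 \<omega>) \<partial>M) \<longlongrightarrow> 0) at_top" by simp
  show ?thesis
    unfolding filterlim_at_top
  proof
    fix Z :: real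
    have "\<forall>\<^sub>F s in at_top. (\<integral>\<omega>. exp (- s * D 1 \<omega>) \<partial>M) < exp (- Z)"
      using lim by (rule order_tendstoD) simp
    then show "\<forall>\<^sub>F s in at_top. Z \<le> laplace_exponent \<nu> s"
      using eventually_gt_at_top[of 0]
      by eventually_elim (use laplace_transform[of _ 1] in simp)
  qed
qed

end

section \<open>Asymptotics of the moments\<close>

locale regularly_varying_subordinator = subordinator +
  fixes \<beta> :: real
  assumes regularly_varying: "regularly_varying_at_top (laplace_exponent \<nu>) \<beta>"
    and beta_pos: "0 < \<beta>"
begin

lemma laplace_exponent_pos: "0 < s \<Longrightarrow> 0 < laplace_exponent \<nu> s"
  using regularly_varying by (auto simp: regularly_varying_at_top_def)

lemma laplace_exponent_ratio_tendsto:
  "0 < l \<Longrightarrow> ((\<lambda>t. laplace_exponent \<nu> (l * inverse t) / laplace_exponent \<nu> (inverse t)) \<longlongrightarrow> l powr \<beta>) (at_right 0)"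
  using regularly_varying filterlim_compose[OF _ filterlim_inverse_at_top_right]
  unfolding regularly_varying_at_top_def by blast

text \<open>
  By monotonicity an infinite moment at \<open>t\<close> would make all later moments infinite, and with them the
  Laplace transform.
\<close>

lemma inverse_moment_finite:
  assumes p: "0 < p"
  shows "inverse_moment p t < \<top>"
proof (rule ccontr)
  assume "\<not> inverse_moment p t < \<top>"
  then have top: "inverse_moment p t = \<top>" using top.not_eq_extremum by blast
  have "(\<integral>\<^sup>+u. ennreal (exp (- 1 * u)) * indicator {t<..} u * \<top> \<partial>lborel)
    \<le> (\<integral>\<^sup>+u. ennreal (exp (- 1 * u)) * inverse_moment p u \<partial>lborel)"
  proof (rule nn_integral_mono)
    fix u
    show "ennreal (exp (- 1 * u)) * indicator {t<..} u * \<top> \<le> ennreal (exp (- 1 * u)) * inverse_moment p u"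
    proof (cases "t < u")
      case True
      then have "inverse_moment p t \<le> inverse_moment p u"
        using p by (intro monoD[OF mono_inverse_moment]) auto
      then show ?thesis using top True by (simp add: top_unique)
    qed simp
  qed
  also have "\<dots> < \<top>"
    using laplace_inverse_moment[OF p, of 1] laplace_exponent_pos[of 1] by simp
  also have "(\<integral>\<^sup>+u. ennreal (exp (- 1 * u)) * indicator {t<..} u * \<top> \<partial>lborel) = \<top>"
    using nn_integral_exp_greaterThan[of 1 t] by (subst nn_integral_multc) (auto simp: ennreal_mult_top)
  finally show False by simp
qed

definition real_inverse_moment :: "real \<Rightarrow> real \<Rightarrow> real" where
  "real_inverse_moment p t = enn2real (inverse_moment p t)"

lemma inverse_moment_eq_real:
  "0 < p \<Longrightarrow> inverse_moment p t = ennreal (real_inverse_moment p t)"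
  using inverse_moment_finite[of p t] by (simp add: real_inverse_moment_def)

lemma real_inverse_moment_nonneg: "0 \<le> real_inverse_moment p t"
  by (simp add: real_inverse_moment_def)

lemma mono_real_inverse_moment: "0 < p \<Longrightarrow> mono (real_inverse_moment p)"
  unfolding real_inverse_moment_def using inverse_moment_finite[of p]
  by (intro monoI enn2real_mono monoD[OF mono_inverse_moment]) auto

lemma has_bochner_integral_real_inverse_moment:
  assumes p: "0 < p" and s: "0 < s"
  shows "has_bochner_integral lborel (\<lambda>t. exp (- s * t) * real_inverse_moment p t)
    (Gamma (p + 1) / (s * laplace_exponent \<nu> s powr p))"
proof (rule has_bochner_integral_nn_integral)
  have "real_inverse_moment p \<in> borel_measurable borel"
    unfolding real_inverse_moment_def by measurable
  then show "(\<lambda>t. exp (- s * t) * real_inverse_moment p t) \<in> borel_measurable lborel"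
    by simp
  show "(\<integral>\<^sup>+t. ennreal (exp (- s * t) * real_inverse_moment p t) \<partial>lborel)
      = ennreal (Gamma (p + 1) / (s * laplace_exponent \<nu> s powr p))"
    using laplace_inverse_moment[OF p s laplace_exponent_pos[OF s]] inverse_moment_eq_real[OF p]
    by (simp add: ennreal_mult' real_inverse_moment_nonneg)
qed (use p s in \<open>auto simp: real_inverse_moment_nonneg intro!: divide_nonneg_nonneg Gamma_real_nonneg\<close>)

lemma has_bochner_integral_scaled_inverse_moment:
  assumes p: "0 < p" and l: "0 < l" and t: "0 < t"
  shows "has_bochner_integral lborel (\<lambda>x. exp (- l * x) * real_inverse_moment p (t * x))
    (Gamma (p + 1) / (l * laplace_exponent \<nu> (l * inverse t) powr p))"
proof -
  have "0 < l * inverse t" using l t by simp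
  from has_bochner_integral_real_inverse_moment[OF p this] show ?thesis
    using t l by (subst (asm) lborel_has_bochner_integral_real_affine_iff[of t _ _ 0])
      (auto simp: field_simps)
qed

lemma one_sided_laplace_scaled_inverse_moment:
  assumes p: "0 < p" and t: "0 < t" and k: "0 \<le> k"
  shows "one_sided_laplace (\<lambda>x. k * real_inverse_moment p (t * x))"
proof -
  have [measurable]: "real_inverse_moment p \<in> borel_measurable borel"
    unfolding real_inverse_moment_def by measurable
  have "real_inverse_moment p (t * x) = 0" if "x \<le> 0" for x
    using inverse_moment_nonpos[OF p, of "t * x"] that t
    by (simp add: real_inverse_moment_def mult_nonneg_nonpos)
  moreover have "integrable lborel (\<lambda>x. exp (- l * x) * (k * real_inverse_moment p (t * x)))" if "0 < l" for l
    using has_bochner_integral_scaled_inverse_moment[OF p that t, THEN integrable.intros]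
    by (simp add: mult.left_commute[of _ k])
  ultimately show ?thesis
    using k by (auto simp: one_sided_laplace_def real_inverse_moment_nonneg)
qed

text \<open>
  The Laplace transform of \<open>x \<mapsto> E[E\<^sub>t\<^sub>x\<^sup>p] \<phi>(1/t)\<^sup>p\<close> at \<open>l\<close> is \<open>\<Gamma>(p+1)/l\<close> times the power \<open>- p\<close> of the ratio
  \<open>\<phi>(l/t) / \<phi>(1/t)\<close>. Regular variation makes it converge to the Laplace transform of a multiple of
  \<open>x powr (p * \<beta>)\<close>, and the Tauberian lemma is applied at \<open>x = 1\<close>.
\<close>

lemma real_inverse_moment_asymp:
  assumes p: "0 < p"
  shows "((\<lambda>t. real_inverse_moment p t * laplace_exponent \<nu> (inverse t) powr p)
    \<longlongrightarrow> Gamma (p + 1) / Gamma (p * \<beta> + 1)) (at_right 0)"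
proof -
  let ?phi = "laplace_exponent \<nu>"
  define c where "c = Gamma (p + 1) / Gamma (p * \<beta> + 1)"
  have Gpos: "0 < Gamma (p * \<beta> + 1)" "0 < Gamma (p + 1)"
    using p beta_pos by (auto intro!: Gamma_real_pos add_pos_pos)
  have "((\<lambda>t. ?phi (inverse t) powr p * real_inverse_moment p (t * 1)) \<longlongrightarrow> c * max 0 1 powr (p * \<beta>)) (at_right 0)"
  proof (rule tendsto_of_tendsto_laplace[where g="\<lambda>x. c * max 0 x powr (p * \<beta>)"])
    show "one_sided_laplace (\<lambda>x. c * max 0 x powr (p * \<beta>))"
      using p beta_pos Gpos by (intro one_sided_laplace_powr) (auto simp: c_def)
    show "\<forall>\<^sub>F t in at_right 0. one_sided_laplace (\<lambda>x. ?phi (inverse t) powr p * real_inverse_moment p (t * x)) \<and>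
        mono (\<lambda>x. ?phi (inverse t) powr p * real_inverse_moment p (t * x))"
      using eventually_at_right_less[of 0]
    proof eventually_elim
      case (elim t)
      then show ?case using p
        by (auto intro!: one_sided_laplace_scaled_inverse_moment monoI mult_left_mono monoD[OF mono_real_inverse_moment])
    qed
    show "isCont (\<lambda>x. c * max 0 x powr (p * \<beta>)) 1"
      by (intro continuous_intros) auto
    fix l :: real assume l: "0 < l"
    have "((\<lambda>t. Gamma (p + 1) / l * (?phi (l * inverse t) / ?phi (inverse t)) powr (- p))
        \<longlongrightarrow> Gamma (p + 1) / l * (l powr \<beta>) powr (- p)) (at_right 0)"
      using l by (intro tendsto_intros laplace_exponent_ratio_tendsto) auto
    then have "((\<lambda>t. \<integral>x. exp (- l * x) * (?phi (inverse t) powr p * real_inverse_moment p (t * x)) \<partial>lborel)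
        \<longlongrightarrow> Gamma (p + 1) / l * (l powr \<beta>) powr (- p)) (at_right 0)"
    proof (rule Lim_transform_eventually)
      show "\<forall>\<^sub>F t in at_right 0. Gamma (p + 1) / l * (?phi (l * inverse t) / ?phi (inverse t)) powr (- p)
          = (\<integral>x. exp (- l * x) * (?phi (inverse t) powr p * real_inverse_moment p (t * x)) \<partial>lborel)"
        using eventually_at_right_less[of 0]
      proof eventually_elim
        case (elim t)
        have phi: "0 < ?phi (inverse t)" "0 < ?phi (l * inverse t)"
          using elim l by (auto intro!: laplace_exponent_pos)
        have "(\<integral>x. exp (- l * x) * (?phi (inverse t) powr p * real_inverse_moment p (t * x)) \<partial>lborel)
          = ?phi (inverse t) powr p * (Gamma (p + 1) / (l * ?phi (l * inverse t) powr p))"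
          using has_bochner_integral_integral_eq[OF has_bochner_integral_scaled_inverse_moment[OF p l elim]]
          by (simp add: mult.left_commute[of _ "?phi (inverse t) powr p"])
        also have "\<dots> = Gamma (p + 1) / l * (?phi (l * inverse t) / ?phi (inverse t)) powr (- p)"
          using phi by (simp add: powr_minus powr_divide field_simps)
        finally show ?case by simp
      qed
    qed
    moreover have "Gamma (p + 1) / l * (l powr \<beta>) powr (- p)
        = (\<integral>x. exp (- l * x) * (c * max 0 x powr (p * \<beta>)) \<partial>lborel)"
    proof -
      have "(\<integral>x. exp (- l * x) * (c * max 0 x powr (p * \<beta>)) \<partial>lborel)
        = c * (Gamma (p * \<beta> + 1) / l powr (p * \<beta> + 1))"
        using has_bochner_integral_integral_eq[OF has_bochner_integral_exp_powr[of "p * \<beta>" l]] p beta_pos l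
        by (simp add: mult.left_commute[of _ c])
      also have "\<dots> = Gamma (p + 1) / l * (l powr \<beta>) powr (- p)"
        using l Gpos by (simp add: c_def powr_powr powr_add powr_minus field_simps)
      finally show ?thesis by simp
    qed
    ultimately show "((\<lambda>t. \<integral>x. exp (- l * x) * (?phi (inverse t) powr p * real_inverse_moment p (t * x)) \<partial>lborel)
        \<longlongrightarrow> (\<integral>x. exp (- l * x) * (c * max 0 x powr (p * \<beta>)) \<partial>lborel)) (at_right 0)"
      by simp
  qed simp
  then show ?thesis by (simp add: c_def mult.commute)
qed

definition real_truncated_moment :: "real \<Rightarrow> real \<Rightarrow> real \<Rightarrow> real" where
  "real_truncated_moment d p t = enn2real (truncated_inverse_moment d p t)"

lemma truncated_inverse_moment_eq_real:
  "0 < p \<Longrightarrow> truncated_inverse_moment d p t = ennreal (real_truncated_moment d p t)"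
  using le_less_trans[OF truncated_inverse_moment_le inverse_moment_finite[of p t], of d]
  by (simp add: real_truncated_moment_def)

text \<open>
  The truncation error is at most \<open>1 / d\<close> times the moment of order \<open>p + 1\<close>. By
  \<open>real_inverse_moment_asymp\<close> for the exponent \<open>p + 1\<close> this is of order \<open>\<phi>(1/t)\<close> to the power \<open>- (p + 1)\<close>,
  hence negligible, since \<open>\<phi>(1/t)\<close> tends to infinity.
\<close>

lemma real_truncated_moment_asymp:
  assumes p: "0 < p" and d: "0 < d"
  shows "((\<lambda>t. real_truncated_moment d p t * laplace_exponent \<nu> (inverse t) powr p)
    \<longlongrightarrow> Gamma (p + 1) / Gamma (p * \<beta> + 1)) (at_right 0)"
proof -
  let ?phi = "\<lambda>t. laplace_exponent \<nu> (inverse t)"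
  let ?C = "Gamma (p + 1) / Gamma (p * \<beta> + 1)"
  have nonneg: "0 \<le> real_truncated_moment d p t" for t by (simp add: real_truncated_moment_def)
  have upper: "real_truncated_moment d p t \<le> real_inverse_moment p t" for t
    using truncated_inverse_moment_le[of d p t] p
    by (simp add: truncated_inverse_moment_eq_real inverse_moment_eq_real real_inverse_moment_nonneg)
  have lower: "real_inverse_moment p t - 1 / d * real_inverse_moment (p + 1) t \<le> real_truncated_moment d p t" for t
  proof -
    have "ennreal (real_inverse_moment p t)
      \<le> ennreal (real_truncated_moment d p t + 1 / d * real_inverse_moment (p + 1) t)"
      using inverse_moment_truncation_le[OF p d, of t] p d nonneg real_inverse_moment_nonneg
      by (simp add: truncated_inverse_moment_eq_real inverse_moment_eq_real flip: ennreal_mult' ennreal_plus)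
    then have "real_inverse_moment p t \<le> real_truncated_moment d p t + 1 / d * real_inverse_moment (p + 1) t"
      using nonneg d real_inverse_moment_nonneg
      by (subst (asm) ennreal_le_iff) (auto intro!: add_nonneg_nonneg mult_nonneg_nonneg)
    then show ?thesis by simp
  qed
  have inv0: "((\<lambda>t. inverse (?phi t)) \<longlongrightarrow> 0) (at_right 0)"
    by (intro tendsto_inverse_0_at_top filterlim_compose[OF laplace_exponent_at_top] filterlim_inverse_at_top_right)
  have "((\<lambda>t. real_inverse_moment p t * ?phi t powr p
      - 1 / d * ((real_inverse_moment (p + 1) t * ?phi t powr (p + 1)) * inverse (?phi t)))
      \<longlongrightarrow> ?C - 1 / d * (Gamma (p + 1 + 1) / Gamma ((p + 1) * \<beta> + 1) * 0)) (at_right 0)"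
    using p by (intro tendsto_diff tendsto_mult tendsto_const real_inverse_moment_asymp inv0) auto
  then have lim: "((\<lambda>t. real_inverse_moment p t * ?phi t powr p
      - 1 / d * ((real_inverse_moment (p + 1) t * ?phi t powr (p + 1)) * inverse (?phi t)))
      \<longlongrightarrow> ?C) (at_right 0)" by simp
  show ?thesis
  proof (rule tendsto_sandwich[OF _ _ lim real_inverse_moment_asymp[OF p]])
    show "\<forall>\<^sub>F t in at_right 0. real_truncated_moment d p t * ?phi t powr p \<le> real_inverse_moment p t * ?phi t powr p"
      using upper by (intro always_eventually allI mult_right_mono) auto
    show "\<forall>\<^sub>F t in at_right 0. real_inverse_moment p t * ?phi t powr p
        - 1 / d * ((real_inverse_moment (p + 1) t * ?phi t powr (p + 1)) * inverse (?phi t))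
        \<le> real_truncated_moment d p t * ?phi t powr p"
      using eventually_at_right_less[of 0]
    proof eventually_elim
      case (elim t)
      then have phi: "0 < ?phi t" by (intro laplace_exponent_pos) auto
      have "real_inverse_moment p t * ?phi t powr p
        - 1 / d * ((real_inverse_moment (p + 1) t * ?phi t powr (p + 1)) * inverse (?phi t))
        = (real_inverse_moment p t - 1 / d * real_inverse_moment (p + 1) t) * ?phi t powr p"
        using phi by (simp add: powr_add algebra_simps)
      also have "\<dots> \<le> real_truncated_moment d p t * ?phi t powr p"
        using lower by (intro mult_right_mono) auto
      finally show ?case .
    qed
  qed
qed

end

theorem proposition4p2:
  fixes M :: "'a measure" and D :: "real \<Rightarrow> 'a \<Rightarrow> real"
    and \<nu> :: "real measure" and \<beta> :: real and E :: "real \<Rightarrow> 'a \<Rightarrow> ennreal"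
  assumes "0 < \<beta>" and "\<beta> < 1"
    and "subordinator M D \<nu>"
    and "regularly_varying_at_top (laplace_exponent \<nu>) \<beta>"
    and E_def: "E = inverse_process D"
  shows "(\<forall>p>0. \<forall>\<delta>>0.
           ennreal_asymp_equiv
             (\<lambda>t. \<integral>\<^sup>+\<omega>. ennreal_powr (E t \<omega>) p \<partial>M)
             (at_right 0)
             (\<lambda>t. \<integral>\<^sup>+\<omega>. ennreal_powr (E t \<omega>) p * indicator {..ennreal \<delta>} (E t \<omega>) \<partial>M) \<and>
           ennreal_asymp_equiv
             (\<lambda>t. \<integral>\<^sup>+\<omega>. ennreal_powr (E t \<omega>) p * indicator {..ennreal \<delta>} (E t \<omega>) \<partial>M)
             (at_right 0)
             (\<lambda>t. ennreal (Gamma (p + 1) / Gamma (p * \<beta> + 1)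
                             * laplace_exponent \<nu> (inverse t) powr (- p)))) \<and>
         (\<forall>\<delta>1>0. \<forall>\<delta>2>0.
           ((\<lambda>t. (\<integral>\<^sup>+\<omega>. ennreal_sqrt (E t \<omega>) * indicator {..ennreal \<delta>1} (E t \<omega>) \<partial>M) /
                 (\<integral>\<^sup>+\<omega>. ennreal_sqrt (E t \<omega>) * indicator {..ennreal \<delta>2} (E t \<omega>) \<partial>M))
             \<longlongrightarrow> 1) (at_right 0))"
proof -
  interpret regularly_varying_subordinator M D \<nu> \<beta>
    by (intro regularly_varying_subordinator.intro regularly_varying_subordinator_axioms.intro assms)
  let ?C = "\<lambda>p. Gamma (p + 1) / Gamma (p * \<beta> + 1)"
  let ?phi = "\<lambda>t. laplace_exponent \<nu> (inverse t)"
  have C: "0 < ?C p" if "0 < p" for p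
    using that beta_pos by (intro divide_pos_pos Gamma_real_pos add_pos_pos mult_pos_pos) auto
  (* The claimed asymptotic form, multiplied by the gauge, is eventually constant. *)
  have gauge: "((\<lambda>t. ?C p * ?phi t powr (- p) * ?phi t powr p) \<longlongrightarrow> ?C p) (at_right 0)" for p
  proof (rule tendsto_eventually)
    show "\<forall>\<^sub>F t in at_right 0. ?C p * ?phi t powr (- p) * ?phi t powr p = ?C p"
      using eventually_at_right_less[of 0]
    proof eventually_elim
      case (elim t)
      then have "0 < ?phi t" by (intro laplace_exponent_pos) auto
      then show ?case by (simp add: mult.assoc flip: powr_add)
    qed
  qed
  have nonneg: "0 \<le> real_truncated_moment d p t" for d p t by (simp add: real_truncated_moment_def)
  show ?thesis
    unfolding E_def ennreal_sqrt_eq_powr ennreal_asymp_equiv_def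
      inverse_moment_eq[symmetric] truncated_inverse_moment_eq[symmetric]
  proof (intro conjI allI impI)
    fix p d :: real assume p: "0 < p" and d: "0 < d"
    show "((\<lambda>t. inverse_moment p t / truncated_inverse_moment d p t) \<longlongrightarrow> 1) (at_right 0)"
      unfolding inverse_moment_eq_real[OF p] truncated_inverse_moment_eq_real[OF p]
      by (rule ennreal_quotient_tendsto_1[OF real_inverse_moment_asymp[OF p] real_truncated_moment_asymp[OF p d] C[OF p]
        real_inverse_moment_nonneg nonneg])
    show "((\<lambda>t. truncated_inverse_moment d p t / ennreal (?C p * ?phi t powr (- p))) \<longlongrightarrow> 1) (at_right 0)"
      unfolding truncated_inverse_moment_eq_real[OF p]
      by (rule ennreal_quotient_tendsto_1[OF real_truncated_moment_asymp[OF p d] gauge C[OF p] nonneg])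
         (intro mult_nonneg_nonneg less_imp_le[OF C[OF p]] powr_ge_zero)
  next
    fix d1 d2 :: real assume d: "0 < d1" "0 < d2"
    have half: "0 < (1 / 2 :: real)" by simp
    show "((\<lambda>t. truncated_inverse_moment d1 (1 / 2) t / truncated_inverse_moment d2 (1 / 2) t) \<longlongrightarrow> 1) (at_right 0)"
      unfolding truncated_inverse_moment_eq_real[OF half]
      by (rule ennreal_quotient_tendsto_1[OF real_truncated_moment_asymp[OF half d(1)]
        real_truncated_moment_asymp[OF half d(2)] C[OF half] nonneg nonneg])
  qed
qed

end
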